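(* Let $F$ be a field of characteristic zero and let $A=UT_3(F)$ be the algebra of $3\times3$ upper triangular matrices with the elementary $\mathbb{Z}_2$-grading induced by $(0,1,0)$ (that is, $A_0=\mathrm{span}_F\{e_{11},e_{22},e_{33},e_{13}\}$ and $A_1=\mathrm{span}_F\{e_{12},e_{23}\}$) and the super-reflection superinvolution $$\begin{pmatrix} a&b&c\\ 0&d&e\\ 0&0&f\end{pmatrix}^{\bar\circ}=\begin{pmatrix} f&e&-c\\ 0&d&b\\ 0&0&a\end{pmatrix}.$$ Let $m\ge1$, let $\Lambda_m=\{w_1,\dots,w_m\}$ be a set of $m$ distinct variables from $Y^+\cup Y^-\cup Z^+\cup Z^-$, and let $f\in P_{\Lambda_m}=\mathrm{span}_F\{w_{\sigma(1)}\cdots w_{\sigma(m)}\mid\sigma\in S_m\}$. Then the image of $f$ on $A$ is a vector space. Moreover, the image can be explicitly computed.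
   Context: For a superalgebra $A=A_0\oplus A_1$ with superinvolution $*$ (a linear map preserving the grading, of order at most 2, with $(ab)^*=(-1)^{|a||b|}b^*a^*$ for homogeneous $a,b$), put $A_i^\pm=\{a\in A_i: a^*=\pm a\}$. The free algebra with superinvolution is generated by the variables $Y^+=\{y_i^+\}$, $Y^-=\{y_i^-\}$, $Z^+=\{z_i^+\}$, $Z^-=\{z_i^-\}$, $i\ge1$. Evaluations on $A$ substitute elements of $A_0^+$ for variables in $Y^+$, of $A_0^-$ for $Y^-$, of $A_1^+$ for $Z^+$, and of $A_1^-$ for $Z^-$. The image of a polynomial $f$ on $A$ is the set of all values of $f$ under such evaluations. In the case at hand $A_0^+=\mathrm{span}_F\{e_{11}+e_{33},e_{22}\}$, $A_0^-=\mathrm{span}_F\{e_{11}-e_{33},e_{13}\}$, $A_1^+=\mathrm{span}_F\{e_{12}+e_{23}\}$, $A_1^-=\mathrm{span}_F\{e_{12}-e_{23}\}$. "The image can be explicitly computed" is the wording of the source statement; its meaning is given by the source's proof, which finds the following possible images. If $f$ has only even variables (those in $Y^+\cup Y^-$), of which $k$ are in $Y^-$, the image is one of $\{0\}$, $\mathrm{span}_F\{e_{13}\}$, $A_0^+$ (when $k=0$), $A_0^-$ (when $k=1$), or, when $k\ge2$, $\{a e_{11}+(-1)^k a e_{33}: a\in F\}$ or $\{a e_{11}+b e_{13}+(-1)^k a e_{33}: a,b\in F\}$, the case being determined by the coefficients of $f$. If $f$ has exactly one odd variable (in $Z^+\cup Z^-$), the image is a subspace of the 2-dimensional space $A_1$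 (and $A_1$ and every 1-dimensional subspace of $A_1$ occur as images). If $f$ has exactly two odd variables, the image is $\{0\}$ or $\mathrm{span}_F\{e_{13}\}$; with three or more odd variables it is $\{0\}$. *)

theory Defs
  imports "HOL-Analysis.Analysis" "HOL-Library.Poly_Mapping" "HOL-Library.Z2"
begin

section \<open>The superalgebra of upper triangular 3 by 3 matrices\<close>

text \<open>
  On \<^typ>\<open>'a^3^3\<close> the operator \<^term>\<open>(*s)\<close> does not take scalars from
  \<^typ>\<open>'a\<close>, so scalar multiplication is introduced separately. The rows and columns are
  indexed by 1, 2, 3; in the type \<^typ>\<open>3\<close> one has \<open>3 = 0\<close>, hence the
  order of that type must not be used to say that a matrix is upper triangular.
\<close>

definition mscale :: "'a::field \<Rightarrow> 'a^3^3 \<Rightarrow> 'a^3^3" where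
  "mscale c M = (\<chi> i j. c * M $ i $ j)"

interpretation mat3: vector_space "mscale :: 'a::field \<Rightarrow> 'a^3^3 \<Rightarrow> 'a^3^3"
  by unfold_locales (simp_all add: mscale_def vec_eq_iff algebra_simps)

definition E :: "3 \<Rightarrow> 3 \<Rightarrow> ('a::field)^3^3" where
  "E i j = (\<chi> r c. if r = i \<and> c = j then 1 else 0)"

definition UT3 :: "(('a::field)^3^3) set" where
  "UT3 = {M. M $ 2 $ 1 = 0 \<and> M $ 3 $ 1 = 0 \<and> M $ 3 $ 2 = 0}"

text \<open>The elementary grading induced by \<open>(0, 1, 0)\<close>: the matrix unit
  \<open>E i j\<close> is homogeneous of degree \<open>gdeg j - gdeg i\<close>.\<close>

definition gdeg :: "3 \<Rightarrow> bit" where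
  "gdeg i = (if i = 2 then 1 else 0)"

definition A_comp :: "bit \<Rightarrow> (('a::field)^3^3) set" where
  "A_comp g = {M \<in> UT3. \<forall>i j. M $ i $ j \<noteq> 0 \<longrightarrow> gdeg j - gdeg i = g}"

definition super_refl :: "('a::field)^3^3 \<Rightarrow> 'a^3^3" where
  "super_refl M = vector [vector [M $ 3 $ 3, M $ 2 $ 3, - (M $ 1 $ 3)],
                          vector [0,         M $ 2 $ 2, M $ 1 $ 2],
                          vector [0,         0,         M $ 1 $ 1]]"

definition A_plus :: "bit \<Rightarrow> (('a::field)^3^3) set" where
  "A_plus g = {M \<in> A_comp g. super_refl M = M}"

definition A_minus :: "bit \<Rightarrow> (('a::field)^3^3) set" where
  "A_minus g = {M \<in> A_comp g. super_refl M = - M}"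

lemmas mat3_simps = mscale_def E_def UT3_def gdeg_def super_refl_def vec_eq_iff forall_3

lemma in_A_comp_iff:
  "M \<in> A_comp 0 \<longleftrightarrow> M \<in> UT3 \<and> M $ 1 $ 2 = 0 \<and> M $ 2 $ 3 = 0"
  "M \<in> A_comp 1 \<longleftrightarrow> M \<in> UT3 \<and> M $ 1 $ 1 = 0 \<and> M $ 2 $ 2 = 0 \<and> M $ 3 $ 3 = 0 \<and> M $ 1 $ 3 = 0"
  by (auto simp: A_comp_def mat3_simps)

lemma mat3_eq_spanI:
  assumes "mat3.subspace S" and "B \<subseteq> S" and "\<And>M. M \<in> S \<Longrightarrow> M \<in> mat3.span B"
  shows "S = mat3.span B"
  using assms mat3.span_minimal by blast

lemma A_comp_span:
  "A_comp 0 = mat3.span {E 1 1, E 2 2, E 3 3, E 1 3 :: ('a::field)^3^3}"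
  "A_comp 1 = mat3.span {E 1 2, E 2 3 :: ('a::field)^3^3}"
proof -
  show "A_comp 0 = mat3.span {E 1 1, E 2 2, E 3 3, E 1 3 :: 'a^3^3}"
  proof (rule mat3_eq_spanI)
    fix M :: "'a^3^3" assume "M \<in> A_comp 0"
    then have "M = mscale (M $ 1 $ 1) (E 1 1) + mscale (M $ 2 $ 2) (E 2 2)
        + mscale (M $ 3 $ 3) (E 3 3) + mscale (M $ 1 $ 3) (E 1 3)" (is "_ = ?S")
      by (simp add: in_A_comp_iff mat3_simps)
    moreover have "?S \<in> mat3.span {E 1 1, E 2 2, E 3 3, E 1 3}"
      by (intro mat3.span_add mat3.span_scale mat3.span_base) auto
    ultimately show "M \<in> mat3.span {E 1 1, E 2 2, E 3 3, E 1 3}" by simp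
  qed (auto simp: mat3.subspace_def in_A_comp_iff mat3_simps)
  show "A_comp 1 = mat3.span {E 1 2, E 2 3 :: 'a^3^3}"
  proof (rule mat3_eq_spanI)
    fix M :: "'a^3^3" assume "M \<in> A_comp 1"
    then have "M = mscale (M $ 1 $ 2) (E 1 2) + mscale (M $ 2 $ 3) (E 2 3)" (is "_ = ?S")
      by (simp add: in_A_comp_iff mat3_simps)
    moreover have "?S \<in> mat3.span {E 1 2, E 2 3}"
      by (intro mat3.span_add mat3.span_scale mat3.span_base) auto
    ultimately show "M \<in> mat3.span {E 1 2, E 2 3}" by simp
  qed (auto simp: mat3.subspace_def in_A_comp_iff mat3_simps)
qed

text \<open>The super-reflection is a superinvolution.\<close>

lemma super_refl_superinvolution:
  "super_refl (M + N) = super_refl M + super_refl N"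
  "super_refl (mscale c M) = mscale c (super_refl M)"
  "M \<in> UT3 \<Longrightarrow> super_refl (super_refl M) = M"
  "M \<in> A_comp g \<Longrightarrow> super_refl M \<in> A_comp g"
  "M \<in> A_comp g \<Longrightarrow> N \<in> A_comp h \<Longrightarrow>
    super_refl (M ** N) = (if g = 1 \<and> h = 1 then - (super_refl N ** super_refl M)
                           else super_refl N ** super_refl M)"
  by (cases g; cases h;
      simp add: in_A_comp_iff mat3_simps matrix_matrix_mult_def sum_3; fail)+

lemma in_A_plus_minus_iff:
  fixes M :: "('a::field_char_0)^3^3"
  shows "M \<in> A_plus 0 \<longleftrightarrow> M \<in> A_comp 0 \<and> M $ 3 $ 3 = M $ 1 $ 1 \<and> M $ 1 $ 3 = 0"
    and "M \<in> A_minus 0 \<longleftrightarrow> M \<in> A_comp 0 \<and> M $ 3 $ 3 = - (M $ 1 $ 1) \<and> M $ 2 $ 2 = 0"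
    and "M \<in> A_plus 1 \<longleftrightarrow> M \<in> A_comp 1 \<and> M $ 2 $ 3 = M $ 1 $ 2"
    and "M \<in> A_minus 1 \<longleftrightarrow> M \<in> A_comp 1 \<and> M $ 2 $ 3 = - (M $ 1 $ 2)"
proof -
  have *: "x = - x \<longleftrightarrow> x = 0" for x :: 'a
    by (metis add_eq_0_iff mult_2 mult_eq_0_iff neg_equal_0_iff_equal zero_neq_numeral)
  then have **: "- x = x \<longleftrightarrow> x = 0" for x :: 'a by metis
  show "M \<in> A_plus 0 \<longleftrightarrow> M \<in> A_comp 0 \<and> M $ 3 $ 3 = M $ 1 $ 1 \<and> M $ 1 $ 3 = 0"
    "M \<in> A_minus 0 \<longleftrightarrow> M \<in> A_comp 0 \<and> M $ 3 $ 3 = - (M $ 1 $ 1) \<and> M $ 2 $ 2 = 0"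
    "M \<in> A_plus 1 \<longleftrightarrow> M \<in> A_comp 1 \<and> M $ 2 $ 3 = M $ 1 $ 2"
    "M \<in> A_minus 1 \<longleftrightarrow> M \<in> A_comp 1 \<and> M $ 2 $ 3 = - (M $ 1 $ 2)"
    by (auto simp: A_plus_def A_minus_def in_A_comp_iff mat3_simps * **)
qed

lemma A_plus_minus_span:
  "A_plus 0 = mat3.span {E 1 1 + E 3 3, E 2 2 :: ('a::field_char_0)^3^3}"
  "A_minus 0 = mat3.span {E 1 1 - E 3 3, E 1 3 :: ('a::field_char_0)^3^3}"
  "A_plus 1 = mat3.span {E 1 2 + E 2 3 :: ('a::field_char_0)^3^3}"
  "A_minus 1 = mat3.span {E 1 2 - E 2 3 :: ('a::field_char_0)^3^3}"
proof -
  show "A_plus 0 = mat3.span {E 1 1 + E 3 3, E 2 2 :: 'a^3^3}" (is "_ = mat3.span ?B")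
  proof (rule mat3_eq_spanI)
    fix M :: "'a^3^3" assume "M \<in> A_plus 0"
    then have "M = mscale (M $ 1 $ 1) (E 1 1 + E 3 3) + mscale (M $ 2 $ 2) (E 2 2)" (is "_ = ?S")
      by (simp add: in_A_plus_minus_iff in_A_comp_iff mat3_simps)
    moreover have "?S \<in> mat3.span ?B"
      by (intro mat3.span_add mat3.span_scale mat3.span_base) auto
    ultimately show "M \<in> mat3.span ?B" by simp
  qed (auto simp: mat3.subspace_def in_A_plus_minus_iff in_A_comp_iff mat3_simps algebra_simps)
  show "A_minus 0 = mat3.span {E 1 1 - E 3 3, E 1 3 :: 'a^3^3}" (is "_ = mat3.span ?B")
  proof (rule mat3_eq_spanI)
    fix M :: "'a^3^3" assume "M \<in> A_minus 0"
    then have "M = mscale (M $ 1 $ 1) (E 1 1 - E 3 3) + mscale (M $ 1 $ 3) (E 1 3)" (is "_ = ?S")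
      by (simp add: in_A_plus_minus_iff in_A_comp_iff mat3_simps)
    moreover have "?S \<in> mat3.span ?B"
      by (intro mat3.span_add mat3.span_scale mat3.span_base) auto
    ultimately show "M \<in> mat3.span ?B" by simp
  qed (auto simp: mat3.subspace_def in_A_plus_minus_iff in_A_comp_iff mat3_simps algebra_simps)
  show "A_plus 1 = mat3.span {E 1 2 + E 2 3 :: 'a^3^3}" (is "_ = mat3.span ?B")
  proof (rule mat3_eq_spanI)
    fix M :: "'a^3^3" assume "M \<in> A_plus 1"
    then have "M = mscale (M $ 1 $ 2) (E 1 2 + E 2 3)" (is "_ = ?S")
      by (simp add: in_A_plus_minus_iff in_A_comp_iff mat3_simps)
    moreover have "?S \<in> mat3.span ?B"
      by (intro mat3.span_add mat3.span_scale mat3.span_base) auto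
    ultimately show "M \<in> mat3.span ?B" by simp
  qed (auto simp: mat3.subspace_def in_A_plus_minus_iff in_A_comp_iff mat3_simps algebra_simps)
  show "A_minus 1 = mat3.span {E 1 2 - E 2 3 :: 'a^3^3}" (is "_ = mat3.span ?B")
  proof (rule mat3_eq_spanI)
    fix M :: "'a^3^3" assume "M \<in> A_minus 1"
    then have "M = mscale (M $ 1 $ 2) (E 1 2 - E 2 3)" (is "_ = ?S")
      by (simp add: in_A_plus_minus_iff in_A_comp_iff mat3_simps)
    moreover have "?S \<in> mat3.span ?B"
      by (intro mat3.span_add mat3.span_scale mat3.span_base) auto
    ultimately show "M \<in> mat3.span ?B" by simp
  qed (auto simp: mat3.subspace_def in_A_plus_minus_iff in_A_comp_iff mat3_simps algebra_simps)
qed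

section \<open>Polynomials in graded symmetric and skew variables\<close>

text \<open>
  As every variable is symmetric or skew, the free algebra with superinvolution is the free
  associative algebra on the variables; its elements are the finitely supported families of
  coefficients of words.
\<close>

datatype svar = Yplus nat | Yminus nat | Zplus nat | Zminus nat

fun odd_var :: "svar \<Rightarrow> bool" where
  "odd_var (Yplus _) = False"
| "odd_var (Yminus _) = False"
| "odd_var (Zplus _) = True"
| "odd_var (Zminus _) = True"

fun is_Yminus :: "svar \<Rightarrow> bool" where
  "is_Yminus (Yminus _) = True"
| "is_Yminus _ = False"

type_synonym 'a free_alg = "svar list \<Rightarrow>\<^sub>0 'a"

definition fscale :: "'a::field \<Rightarrow> 'a free_alg \<Rightarrow> 'a free_alg" where
  "fscale c f = Poly_Mapping.map ((*) c) f"

lemma lookup_fscale [simp]: "Poly_Mapping.lookup (fscale c f) xs = c * Poly_Mapping.lookup f xs"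
  by (simp add: fscale_def Poly_Mapping.map.rep_eq when_def)

interpretation free_alg: vector_space "fscale :: 'a::field \<Rightarrow> 'a free_alg \<Rightarrow> 'a free_alg"
  by unfold_locales (auto intro!: poly_mapping_eqI simp: lookup_add algebra_simps)

definition monomial :: "(nat \<Rightarrow> svar) \<Rightarrow> nat \<Rightarrow> (nat \<Rightarrow> nat) \<Rightarrow> ('a::field) free_alg" where
  "monomial w m \<sigma> = Poly_Mapping.single (map (\<lambda>i. w (\<sigma> i)) [1..<Suc m]) 1"

definition multilinear_polys :: "(nat \<Rightarrow> svar) \<Rightarrow> nat \<Rightarrow> ('a::field) free_alg set" where
  "multilinear_polys w m = free_alg.span {monomial w m \<sigma> | \<sigma>. \<sigma> permutes {1..m}}"

fun var_dom :: "svar \<Rightarrow> (('a::field)^3^3) set" where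
  "var_dom (Yplus _) = A_plus 0"
| "var_dom (Yminus _) = A_minus 0"
| "var_dom (Zplus _) = A_plus 1"
| "var_dom (Zminus _) = A_minus 1"

definition word_eval :: "(svar \<Rightarrow> ('a::field)^3^3) \<Rightarrow> svar list \<Rightarrow> 'a^3^3" where
  "word_eval \<rho> xs = foldr (\<lambda>v M. \<rho> v ** M) xs (mat 1)"

definition poly_eval :: "(svar \<Rightarrow> ('a::field)^3^3) \<Rightarrow> 'a free_alg \<Rightarrow> 'a^3^3" where
  "poly_eval \<rho> f = (\<Sum>xs\<in>Poly_Mapping.keys f. mscale (Poly_Mapping.lookup f xs) (word_eval \<rho> xs))"

definition poly_image :: "('a::field) free_alg \<Rightarrow> ('a^3^3) set" where
  "poly_image f = {poly_eval \<rho> f | \<rho>. \<forall>v. \<rho> v \<in> var_dom v}"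

definition num_odd :: "(nat \<Rightarrow> svar) \<Rightarrow> nat \<Rightarrow> nat" where
  "num_odd w m = card {i \<in> {1..m}. odd_var (w i)}"

definition num_Yminus :: "(nat \<Rightarrow> svar) \<Rightarrow> nat \<Rightarrow> nat" where
  "num_Yminus w m = card {i \<in> {1..m}. is_Yminus (w i)}"

text \<open>
  The coefficients that determine the image of a polynomial without odd variables. A variable
  from \<open>Y\<^sup>+\<close> takes values whose corner on the indices 1 and 3 is scalar, say \<open>a\<close> times
  the identity, while a variable from \<open>Y\<^sup>-\<close> takes values of the form
  \<open>c (E 1 1 - E 3 3) + d E 1 3\<close>. Hence the (1,1) entry of the value of \<open>f\<close> is
  \<open>coeff_sum f\<close> times the product of all the \<open>a\<close> and \<open>c\<close>, and the (1,3) entry is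
  the sum over the \<open>Y\<^sup>-\<close> variables \<open>v\<close> of \<open>corner_coeff v f\<close> times the product of all
  the \<open>a\<close>, of the \<open>d\<close> of \<open>v\<close>, and of the \<open>c\<close> of the other \<open>Y\<^sup>-\<close> variables.
\<close>

definition coeff_sum :: "('a::field) free_alg \<Rightarrow> 'a" where
  "coeff_sum f = (\<Sum>xs\<in>Poly_Mapping.keys f. Poly_Mapping.lookup f xs)"

definition Yminus_after :: "svar \<Rightarrow> svar list \<Rightarrow> nat" where
  "Yminus_after v xs = length (filter is_Yminus (tl (dropWhile (\<lambda>u. u \<noteq> v) xs)))"

definition corner_coeff :: "svar \<Rightarrow> ('a::field) free_alg \<Rightarrow> 'a" where
  "corner_coeff v f =
    (\<Sum>xs\<in>Poly_Mapping.keys f. Poly_Mapping.lookup f xs * (- 1) ^ Yminus_after v xs)"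

definition corner_vanishes :: "(nat \<Rightarrow> svar) \<Rightarrow> nat \<Rightarrow> ('a::field) free_alg \<Rightarrow> bool" where
  "corner_vanishes w m f \<longleftrightarrow> (\<forall>i\<in>{1..m}. is_Yminus (w i) \<longrightarrow> corner_coeff (w i) f = 0)"

end

theory Submission
  imports Defs
begin

text \<open>
  The evaluation of a multilinear polynomial is a multilinear map on the product of the
  spaces of values of its variables. The image of a multilinear map need not be a vector space, but
  it is one as soon as it lies in a space of dimension at most two: it is closed under scalars, so
  only two linearly independent values can cause trouble, and two independent values can
  be replaced by two that arise from arguments differing in a single place
  (\<open>independent_values_span_in_image\<close>). There the map is linear, the whole plane
  spanned by the two values is attained, and this plane is everything.

  All images here are that small. A product with \<open>n\<close> odd factors raises the distance from
  the diagonal by at least \<open>n\<close>, so two odd variables leave only the corner \<open>E 1 3\<close> and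
  three leave nothing; one odd variable puts the value into the plane \<open>A_comp 1\<close>. Without odd
  variables the values have the form \<open>a E 1 1 + c E 2 2 + b E 1 3 + (- 1) ^ k a E 3 3\<close>, where
  \<open>b = 0\<close> if no skew variable occurs and \<open>c = 0\<close> if one occurs.

  To see which of these values are attained, all variables but one are given a value with a 1 in the
  upper left corner and no entry at \<open>(1, 3)\<close>: the identity for \<open>Y\<^sup>+\<close> and
  \<open>E 1 1 - E 3 3\<close> for \<open>Y\<^sup>-\<close>. The (1,1) entry of the remaining variable is then
  multiplied by \<open>coeff_sum\<close> and its (1,3) entry by \<open>corner_coeff\<close>
  (\<open>poly_eval_at_unit_subst\<close>), so one variable with nonzero \<open>corner_coeff\<close> suffices to
  make the two entries of the value independent.

  Conversely, the plane \<open>A_comp 1\<close> and its lines arise from words in one even and one odd variable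
  (\<open>odd_part_is_image\<close>, \<open>odd_line_is_image\<close>).
\<close>

section \<open>Multilinear maps into a plane\<close>

lemma (in vector_space) span_doubleton:
  "span {x, y} = {scale a x + scale b y | a b. True}"
proof -
  have "u - scale a x = scale b y \<longleftrightarrow> u = scale a x + scale b y" for u a b
    by (auto simp: algebra_simps)
  then show ?thesis
    by (auto simp: span_insert)
qed

lemma (in vector_space) independent_pair_sym:
  assumes "x \<noteq> 0" and "y \<notin> span {x}"
  shows "y \<noteq> 0" and "x \<notin> span {y}"
  using assms in_span_insert[of x y "{}"] span_zero by auto

text \<open>
  The map is defined on all families, so that single entries can be changed by function update; only
  the finitely many places in \<open>I\<close> influence its values.
\<close>

locale multilinear_map = vector_space_pair s1 s2
  for s1 :: "'a::field \<Rightarrow> 'b::ab_group_add \<Rightarrow> 'b" (infixr \<open>*a\<close> 75)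
    and s2 :: "'a::field \<Rightarrow> 'c::ab_group_add \<Rightarrow> 'c" (infixr \<open>*b\<close> 75) +
  fixes I :: "'i set" and D :: "'i \<Rightarrow> 'b set" and T :: "('i \<Rightarrow> 'b) \<Rightarrow> 'c"
  assumes finite_places: "finite I" and places_nonempty: "I \<noteq> {}"
    and subspace_D: "vs1.subspace (D i)"
    and linear_at: "i \<in> I \<Longrightarrow> Vector_Spaces.linear s1 s2 (\<lambda>x. T (\<rho>(i := x)))"
    and determined: "(\<And>i. i \<in> I \<Longrightarrow> \<rho> i = \<sigma> i) \<Longrightarrow> T \<rho> = T \<sigma>"
begin

abbreviation attained :: "'c set" where
  "attained \<equiv> {T \<rho> | \<rho>. \<forall>i. \<rho> i \<in> D i}"

lemma add_at: "i \<in> I \<Longrightarrow> T (\<rho>(i := x + y)) = T (\<rho>(i := x)) + T (\<rho>(i := y))"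
  using linear_at by (simp add: Vector_Spaces.linear_iff)

lemma scale_at: "i \<in> I \<Longrightarrow> T (\<rho>(i := c *a x)) = c *b T (\<rho>(i := x))"
  using linear_at by (simp add: Vector_Spaces.linear_iff)

lemma span_values_in_image:
  assumes "i \<in> I" and \<rho>: "\<And>i. \<rho> i \<in> D i" and "x \<in> D i" "y \<in> D i"
  shows "vs2.span {T (\<rho>(i := x)), T (\<rho>(i := y))} \<subseteq> attained"
proof
  fix u assume "u \<in> vs2.span {T (\<rho>(i := x)), T (\<rho>(i := y))}"
  then obtain a b where u: "u = a *b T (\<rho>(i := x)) + b *b T (\<rho>(i := y))"
    by (auto simp: vs2.span_doubleton)
  have "u = T (\<rho>(i := a *a x + b *a y))"
    using \<open>i \<in> I\<close> by (simp add: u add_at scale_at)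
  moreover have "a *a x + b *a y \<in> D i"
    using assms subspace_D by (intro vs1.subspace_add vs1.subspace_scale) auto
  ultimately show "u \<in> attained"
    using \<rho> by (auto intro!: exI[of _ "\<rho>(i := a *a x + b *a y)"])
qed

text \<open>
  The two arguments are made to agree in one more place \<open>i\<close> without losing independence of their
  values. Changing the entry at \<open>i\<close> of the first argument into that of the second gives a
  new value; if it is independent of the second value, the arguments have come closer, and if it is a
  nonzero multiple of the second value, it is independent of the first one and differs from it
  in the place \<open>i\<close> only. The same holds with the arguments exchanged. If both changes give
  zero, putting the sum of the two entries at \<open>i\<close> into both arguments changes neither
  value.
\<close>

lemma independent_values_span_in_image:
  assumes "\<And>i. \<rho> i \<in> D i" and "\<And>i. \<sigma> i \<in> D i"
    and "T \<rho> \<noteq> 0" and "T \<sigma> \<notin> vs2.span {T \<rho>}"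
  shows "\<exists>x y. x \<noteq> 0 \<and> y \<notin> vs2.span {x} \<and> vs2.span {x, y} \<subseteq> attained"
  using assms
proof (induction "card {i \<in> I. \<rho> i \<noteq> \<sigma> i}" arbitrary: \<rho> \<sigma> rule: less_induct)
  case less
  let ?N = "\<lambda>\<rho> \<sigma>. {i \<in> I. \<rho> i \<noteq> \<sigma> i}"
  have "T \<rho> \<noteq> T \<sigma>"
    using less.prems(4) vs2.span_base by auto
  then obtain i where i: "i \<in> I" "\<rho> i \<noteq> \<sigma> i"
    using determined by metis
  have closer: "card (?N (\<rho>(i := x)) (\<sigma>(i := x))) < card (?N \<rho> \<sigma>)" for x
    using i finite_places by (intro psubset_card_mono) auto
  note same = fun_upd_triv[of \<rho> i] fun_upd_triv[of \<sigma> i]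
  note \<rho> = less.prems(1) and \<sigma> = less.prems(2)
  note sym = vs2.independent_pair_sym[OF less.prems(3,4)]
  let ?a = "\<rho> i" and ?b = "\<sigma> i"
  consider (close1) "T (\<rho>(i := ?b)) \<noteq> 0" "T \<sigma> \<notin> vs2.span {T (\<rho>(i := ?b))}"
    | (line1) "T (\<rho>(i := ?b)) \<noteq> 0" "T \<sigma> \<in> vs2.span {T (\<rho>(i := ?b))}"
    | (close2) "T (\<sigma>(i := ?a)) \<notin> vs2.span {T \<rho>}"
    | (line2) "T (\<sigma>(i := ?a)) \<noteq> 0" "T (\<sigma>(i := ?a)) \<in> vs2.span {T \<rho>}"
    | (zero) "T (\<rho>(i := ?b)) = 0" "T (\<sigma>(i := ?a)) = 0"
    by blast
  then show ?case
  proof cases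
    case close1
    show ?thesis
      using less.hyps[of "\<rho>(i := ?b)" \<sigma>] closer[of ?b] \<rho> \<sigma> close1 by (simp add: same)
  next
    case line1
    have "T (\<rho>(i := ?b)) \<notin> vs2.span {T \<rho>}"
      using line1(2) less.prems(4) vs2.span_minimal[of "{T (\<rho>(i := ?b))}" "vs2.span {T \<rho>}"]
      by auto
    moreover have "vs2.span {T \<rho>, T (\<rho>(i := ?b))} \<subseteq> attained"
      using span_values_in_image[OF i(1), of \<rho> ?a ?b] \<rho> \<sigma> by simp
    ultimately show ?thesis
      using less.prems(3) by blast
  next
    case close2
    show ?thesis
      using less.hyps[of \<rho> "\<sigma>(i := ?a)"] closer[of ?a] \<rho> \<sigma> less.prems(3) close2
      by (simp add: same)
  next
    case line2
    have "T (\<sigma>(i := ?a)) \<notin> vs2.span {T \<sigma>}"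
    proof
      assume "T (\<sigma>(i := ?a)) \<in> vs2.span {T \<sigma>}"
      then have "T \<sigma> \<in> vs2.span {T (\<sigma>(i := ?a))}"
        using vs2.independent_pair_sym(2)[OF line2(1)] by blast
      then show False
        using line2(2) less.prems(4)
          vs2.span_minimal[of "{T (\<sigma>(i := ?a))}" "vs2.span {T \<rho>}"] by auto
    qed
    moreover have "vs2.span {T \<sigma>, T (\<sigma>(i := ?a))} \<subseteq> attained"
      using span_values_in_image[OF i(1), of \<sigma> ?b ?a] \<rho> \<sigma> by simp
    ultimately show ?thesis
      using sym(1) by blast
  next
    case zero
    have *: "T (\<rho>(i := ?a + ?b)) = T \<rho>" "T (\<sigma>(i := ?a + ?b)) = T \<sigma>"
      using zero by (simp_all add: add_at[OF i(1)])
    have "?a + ?b \<in> D i"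
      using subspace_D \<rho> \<sigma> by (intro vs1.subspace_add) auto
    then show ?thesis
      using less.hyps[of "\<rho>(i := ?a + ?b)" "\<sigma>(i := ?a + ?b)"] closer[of "?a + ?b"]
        * \<rho> \<sigma> less.prems(3,4) by simp
  qed
qed

text \<open>
  Without two independent values the image is a line or zero; with them it contains, and hence
  is, the plane that it lies in.
\<close>

lemma subspace_values:
  assumes plane: "attained \<subseteq> vs2.span {p, q}"
  shows "vs2.subspace attained"
proof -
  obtain j where j: "j \<in> I"
    using places_nonempty by blast
  have scale_in: "c *b u \<in> attained" if u: "u \<in> attained" for c u
  proof -
    obtain \<rho> where \<rho>: "u = T \<rho>" "\<forall>i. \<rho> i \<in> D i"
      using u by blast
    have "c *b u = T (\<rho>(j := c *a \<rho> j))"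
      using scale_at[OF j, of \<rho> c "\<rho> j"] by (simp add: \<rho>(1))
    moreover have "c *a \<rho> j \<in> D j"
      using subspace_D \<rho>(2) by (simp add: vs1.subspace_scale)
    ultimately show ?thesis
      using \<rho>(2) by (auto intro!: exI[of _ "\<rho>(j := c *a \<rho> j)"])
  qed
  have zero_in: "0 \<in> attained"
    using scale_in[of "T (\<lambda>_. 0)" 0] subspace_D vs1.subspace_0 by auto
  show ?thesis
  proof (cases "\<exists>\<rho> \<sigma>. (\<forall>i. \<rho> i \<in> D i) \<and> (\<forall>i. \<sigma> i \<in> D i) \<and> T \<rho> \<noteq> 0 \<and> T \<sigma> \<notin> vs2.span {T \<rho>}")
    case True
    then obtain x y where xy: "x \<noteq> 0" "y \<notin> vs2.span {x}" "vs2.span {x, y} \<subseteq> attained"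
      using independent_values_span_in_image by blast
    have "x \<noteq> y"
      using xy(2) vs2.span_base by auto
    have ind: "vs2.independent {y, x}"
      using xy(1,2) by (simp add: vs2.independent_insert)
    have "z \<in> vs2.span {y, x}" if z: "z \<in> vs2.span {p, q}" for z
    proof (rule ccontr)
      \<comment> \<open>Three independent vectors do not fit into the span of two.\<close>
      assume z': "z \<notin> vs2.span {y, x}"
      then have zxy: "z \<noteq> x" "z \<noteq> y"
        using vs2.span_base by auto
      have "vs2.independent {z, y, x}"
        using z' ind by (rule vs2.independent_insertI)
      moreover have "{z, y, x} \<subseteq> vs2.span {p, q}"
        using xy(3) plane vs2.span_base z by blast
      ultimately have "card {z, y, x} \<le> card {p, q}"
        using vs2.independent_span_bound[of "{p, q}" "{z, y, x}"] by simp
      then show False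
        using \<open>x \<noteq> y\<close> zxy by (simp add: card_insert_if split: if_splits)
    qed
    then have "attained = vs2.span {x, y}"
      using xy(3) plane unfolding insert_commute[of y x] by blast
    then show ?thesis by simp
  next
    case False
    then have parallel: "v \<in> vs2.span {u}" if "u \<in> attained" "v \<in> attained" "u \<noteq> 0" for u v
      using that by blast
    have "u + v \<in> attained" if uv: "u \<in> attained" "v \<in> attained" for u v
    proof (cases "u = 0")
      case False
      then obtain c where "v = c *b u"
        using parallel[OF uv] by (auto simp: vs2.span_singleton)
      then have "u + v = (1 + c) *b u"
        by (simp add: vs2.scale_left_distrib)
      then show ?thesis using scale_in[OF uv(1)] by simp
    qed (use uv in simp)
    then show ?thesis
      using zero_in scale_in by (simp add: vs2.subspace_def)
  qed
qed

end

interpretation mat3_pair: vector_space_pair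
  "mscale :: 'a::field \<Rightarrow> 'a^3^3 \<Rightarrow> 'a^3^3" "mscale :: 'a::field \<Rightarrow> 'a^3^3 \<Rightarrow> 'a^3^3"
  by unfold_locales


section \<open>Evaluations are multilinear\<close>

text \<open>
  Evaluations do not depend on how the variables are numbered, so from here on only the set \<open>V\<close> of
  the variables of a multilinear polynomial is kept.
\<close>

definition multilinear_in :: "svar set \<Rightarrow> ('a::field) free_alg \<Rightarrow> bool" where
  "multilinear_in V f \<longleftrightarrow> (\<forall>xs\<in>Poly_Mapping.keys f. distinct xs \<and> set xs = V)"

lemma multilinear_in_multilinear_polys:
  fixes f :: "('a::field) free_alg"
  assumes "inj_on w {1..m}" and "f \<in> multilinear_polys w m"
  shows "multilinear_in (w ` {1..m}) f"
proof -
  let ?S = "{f :: 'a free_alg. multilinear_in (w ` {1..m}) f}"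
  have "free_alg.subspace ?S"
  proof (rule free_alg.subspaceI)
    show "f + g \<in> ?S" if "f \<in> ?S" "g \<in> ?S" for f g :: "'a free_alg"
      using that Poly_Mapping.keys_add[of f g] by (auto simp: multilinear_in_def)
  qed (auto simp: multilinear_in_def in_keys_iff)
  moreover have "monomial w m \<sigma> \<in> ?S" if \<sigma>: "\<sigma> permutes {1..m}" for \<sigma>
  proof -
    have "inj_on (\<lambda>i. w (\<sigma> i)) {1..<Suc m}"
      using assms(1) permutes_inj_on[OF \<sigma>] permutes_image[OF \<sigma>] comp_inj_on[of \<sigma> "{1..m}" w]
      by (simp add: o_def atLeastLessThanSuc_atLeastAtMost)
    moreover have "(\<lambda>i. w (\<sigma> i)) ` {1..<Suc m} = w ` {1..m}"
      using permutes_image[OF \<sigma>]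
      by (metis image_image atLeastLessThanSuc_atLeastAtMost)
    ultimately show ?thesis
      by (simp add: multilinear_in_def monomial_def distinct_map del: upt_Suc)
  qed
  ultimately have "free_alg.span {monomial w m \<sigma> | \<sigma>. \<sigma> permutes {1..m}} \<subseteq> ?S"
    by (intro free_alg.span_minimal) auto
  then show ?thesis
    using assms(2) by (auto simp: multilinear_polys_def)
qed

lemma mscale_matrix_mult:
  fixes A B :: "('a::field)^3^3"
  shows "mscale c A ** B = mscale c (A ** B)" and "A ** mscale c B = mscale c (A ** B)"
  by (simp_all add: mscale_def matrix_matrix_mult_def vec_eq_iff sum_distrib_left algebra_simps)

lemma matrix_add_rdistrib: "(A + B) ** C = A ** C + B ** C"
  by (simp add: matrix_matrix_mult_def vec_eq_iff sum.distrib algebra_simps)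

lemma mscale_nth [simp]: "mscale c M $ i $ j = c * M $ i $ j"
  by (simp add: mscale_def)

lemma word_eval_Nil [simp]: "word_eval \<rho> [] = mat 1"
  and word_eval_Cons [simp]: "word_eval \<rho> (v # xs) = \<rho> v ** word_eval \<rho> xs"
  by (simp_all add: word_eval_def)

lemma word_eval_cong:
  "(\<And>v. v \<in> set xs \<Longrightarrow> \<rho> v = \<sigma> v) \<Longrightarrow> word_eval \<rho> xs = word_eval \<sigma> xs"
  by (induction xs) auto

lemma word_eval_upd_notin: "v \<notin> set xs \<Longrightarrow> word_eval (\<rho>(v := x)) xs = word_eval \<rho> xs"
  by (rule word_eval_cong) auto

text \<open>As \<open>v\<close> occurs only once, exactly one factor of the product depends on \<open>x\<close>.\<close>

lemma linear_word_eval: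
  assumes "distinct xs" and "v \<in> set xs"
  shows "Vector_Spaces.linear mscale mscale (\<lambda>x. word_eval (\<rho>(v := x)) xs)"
  using assms
proof (induction xs)
  case (Cons u xs)
  show ?case
  proof (cases "u = v")
    case True
    then have *: "(\<lambda>x. word_eval (\<rho>(v := x)) (u # xs)) = (\<lambda>x. x ** word_eval \<rho> xs)"
      using Cons.prems by (simp add: word_eval_upd_notin)
    show ?thesis
      using mat3.vector_space_axioms
      unfolding * by (simp add: Vector_Spaces.linear_iff matrix_add_rdistrib mscale_matrix_mult)
  next
    case False
    then show ?thesis
      using Cons by (simp add: Vector_Spaces.linear_iff matrix_add_ldistrib mscale_matrix_mult)
  qed
qed simp

lemma subspace_var_dom: "mat3.subspace (var_dom v :: (('a::field_char_0)^3^3) set)"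
  by (cases v) (simp_all add: A_plus_minus_span)

lemma multilinear_poly_eval:
  fixes f :: "('a::field_char_0) free_alg"
  assumes "multilinear_in V f" and "finite V" and "V \<noteq> {}"
  shows "multilinear_map mscale mscale V var_dom (\<lambda>\<rho>. poly_eval \<rho> f)"
proof (intro multilinear_map.intro multilinear_map_axioms.intro mat3_pair.vector_space_pair_axioms,
    goal_cases)
  case 1 show ?case by fact
next
  case 2 show ?case by fact
next
  case 3 show ?case by (rule subspace_var_dom)
next
  case (4 v \<rho>)
  then have "Vector_Spaces.linear mscale mscale (\<lambda>x. word_eval (\<rho>(v := x)) xs)"
    if "xs \<in> Poly_Mapping.keys f" for xs
    using that assms(1) by (intro linear_word_eval) (auto simp: multilinear_in_def)
  then show ?case
    unfolding poly_eval_def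
    by (intro mat3_pair.linear_compose_sum ballI mat3_pair.linear_compose_scale_right)
next
  case (5 \<rho> \<sigma>)
  then show ?case
    using assms(1) unfolding poly_eval_def multilinear_in_def
    by (intro sum.cong refl arg_cong2[of _ _ _ _ mscale] word_eval_cong) auto
qed

lemma subspace_poly_image:
  fixes f :: "('a::field_char_0) free_alg"
  assumes "multilinear_in V f" "finite V" "V \<noteq> {}" "poly_image f \<subseteq> mat3.span {p, q}"
  shows "mat3.subspace (poly_image f)"
  using multilinear_map.subspace_values[OF multilinear_poly_eval[OF assms(1-3)]] assms(4)
  by (simp add: poly_image_def)

lemma poly_eval_in_subspace:
  assumes "mat3.subspace S"
    and "\<And>xs. xs \<in> Poly_Mapping.keys f \<Longrightarrow> word_eval \<rho> xs \<in> S"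
  shows "poly_eval \<rho> f \<in> S"
  unfolding poly_eval_def
  by (intro mat3.subspace_sum mat3.subspace_scale assms)

lemma poly_eval_nth:
  "poly_eval \<rho> f $ i $ j =
    (\<Sum>xs\<in>Poly_Mapping.keys f. Poly_Mapping.lookup f xs * word_eval \<rho> xs $ i $ j)"
  by (simp add: poly_eval_def)

lemma length_filter_multilinear:
  assumes "multilinear_in V f" "xs \<in> Poly_Mapping.keys f"
  shows "length (filter P xs) = card {v \<in> V. P v}"
  using assms distinct_length_filter[of xs P]
  by (auto simp: multilinear_in_def Int_def conj_commute)


section \<open>Odd variables\<close>

lemma A_comp_mult:
  assumes "M \<in> A_comp g" and "N \<in> A_comp h"
  shows "M ** N \<in> A_comp (g + h)"
  using assms
  by (cases g; cases h) (simp_all add: in_A_comp_iff UT3_def matrix_matrix_mult_def sum_3)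

lemma mat_1_in_A_comp: "mat 1 \<in> A_comp 0"
  by (simp add: in_A_comp_iff UT3_def mat_def)

lemma var_dom_subset_A_comp: "var_dom v \<subseteq> A_comp (of_bool (odd_var v))"
  by (cases v) (auto simp: A_plus_def A_minus_def)

lemma word_eval_graded:
  assumes "\<And>v. \<rho> v \<in> var_dom v"
  shows "word_eval \<rho> xs \<in> A_comp (of_nat (length (filter odd_var xs)))"
proof (induction xs)
  case (Cons v xs)
  have "\<rho> v \<in> A_comp (of_bool (odd_var v))"
    using assms var_dom_subset_A_comp by blast
  from A_comp_mult[OF this Cons] show ?case
    by (cases "odd_var v"; cases "of_nat (length (filter odd_var xs)) :: bit") auto
qed (simp add: mat_1_in_A_comp)

text \<open>
  The distance to the diagonal, \<open>pos j - pos i\<close> for the entry \<open>(i, j)\<close>, is at least the number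
  of odd factors. This is a finer count than the grading, which only sees its parity.
\<close>

definition pos :: "3 \<Rightarrow> nat" where
  "pos i = (if i = 1 then 0 else if i = 2 then 1 else 2)"

definition diagonals_from :: "nat \<Rightarrow> (('a::field)^3^3) set" where
  "diagonals_from n = {M. \<forall>i j. M $ i $ j \<noteq> 0 \<longrightarrow> pos i + n \<le> pos j}"

lemma diagonals_from_mult:
  assumes "M \<in> diagonals_from n" and "N \<in> diagonals_from k"
  shows "M ** N \<in> diagonals_from (n + k)"
  unfolding diagonals_from_def
proof (intro CollectI allI impI)
  fix i j assume "(M ** N) $ i $ j \<noteq> 0"
  then obtain l where "M $ i $ l * N $ l $ j \<noteq> 0"
    by (auto simp: matrix_matrix_mult_def elim: sum.not_neutral_contains_not_neutral)
  then have "pos i + n \<le> pos l" "pos l + k \<le> pos j"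
    using assms by (auto simp: diagonals_from_def)
  then show "pos i + (n + k) \<le> pos j" by simp
qed

lemma var_dom_subset_diagonals_from: "var_dom v \<subseteq> diagonals_from (of_bool (odd_var v))"
  using var_dom_subset_A_comp[of v]
  by (cases "odd_var v")
    (auto simp: diagonals_from_def in_A_comp_iff UT3_def forall_3 pos_def subset_iff)

lemma word_eval_diagonals:
  assumes "\<And>v. \<rho> v \<in> var_dom v"
  shows "word_eval \<rho> xs \<in> diagonals_from (length (filter odd_var xs))"
proof (induction xs)
  case Nil
  show ?case by (simp add: diagonals_from_def mat_def)
next
  case (Cons v xs)
  have "\<rho> v \<in> diagonals_from (of_bool (odd_var v))"
    using assms var_dom_subset_diagonals_from by blast
  from diagonals_from_mult[OF this Cons] show ?case
    by (cases "odd_var v") simp_all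
qed

lemma subspace_A_comp: "mat3.subspace (A_comp g)"
  by (cases g) (simp_all add: A_comp_span)

lemma poly_image_one_odd:
  assumes "multilinear_in V f" and "card {v \<in> V. odd_var v} = 1"
  shows "poly_image f \<subseteq> A_comp 1"
proof -
  have "poly_eval \<rho> f \<in> A_comp 1" if \<rho>: "\<forall>v. \<rho> v \<in> var_dom v" for \<rho>
    using word_eval_graded[of \<rho>] \<rho> length_filter_multilinear[OF assms(1), of _ odd_var] assms(2)
    by (intro poly_eval_in_subspace subspace_A_comp) (metis of_nat_1)
  then show ?thesis by (auto simp: poly_image_def)
qed

lemma subspace_diagonals_from: "mat3.subspace (diagonals_from n)"
proof (rule mat3.subspaceI)
  show "M + N \<in> diagonals_from n" if "M \<in> diagonals_from n" "N \<in> diagonals_from n" for M N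
    using that unfolding diagonals_from_def mem_Collect_eq vector_add_component by (metis add_0)
qed (auto simp: diagonals_from_def)

lemma poly_image_diagonals:
  assumes "multilinear_in V f"
  shows "poly_image f \<subseteq> diagonals_from (card {v \<in> V. odd_var v})"
proof -
  have "poly_eval \<rho> f \<in> diagonals_from (card {v \<in> V. odd_var v})"
    if \<rho>: "\<forall>v. \<rho> v \<in> var_dom v" for \<rho>
    using word_eval_diagonals[of \<rho>] \<rho> length_filter_multilinear[OF assms, of _ odd_var]
    by (intro poly_eval_in_subspace subspace_diagonals_from) metis
  then show ?thesis by (auto simp: poly_image_def)
qed

lemma diagonals_from_2: "diagonals_from 2 \<subseteq> mat3.span {E 1 3}"
proof
  fix M :: "'a^3^3" assume "M \<in> diagonals_from 2"
  then have "M = mscale (M $ 1 $ 3) (E 1 3)"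
    by (auto simp: diagonals_from_def forall_3 pos_def E_def vec_eq_iff)
  then show "M \<in> mat3.span {E 1 3}"
    by (metis mat3.span_base mat3.span_scale insertI1)
qed

lemma diagonals_from_ge_3: "3 \<le> n \<Longrightarrow> diagonals_from n \<subseteq> {0}"
  by (auto simp: diagonals_from_def forall_3 pos_def vec_eq_iff)


section \<open>Even variables\<close>

lemma even_var_dom:
  fixes M :: "('a::field_char_0)^3^3"
  assumes "\<not> odd_var v" and "M \<in> var_dom v"
  shows "M \<in> A_comp 0" and "M $ 3 $ 3 = (if is_Yminus v then - 1 else 1) * M $ 1 $ 1"
    and "is_Yminus v \<Longrightarrow> M $ 2 $ 2 = 0" and "\<not> is_Yminus v \<Longrightarrow> M $ 1 $ 3 = 0"
  using assms by (cases v; simp add: in_A_plus_minus_iff)+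

lemma even_word_diagonal:
  fixes \<rho> :: "svar \<Rightarrow> ('a::field_char_0)^3^3"
  assumes "\<And>v. \<rho> v \<in> var_dom v" and "\<forall>v\<in>set xs. \<not> odd_var v" and "distinct xs"
  shows "word_eval \<rho> xs \<in> A_comp 0"
    and "word_eval \<rho> xs $ 1 $ 1 = (\<Prod>v\<in>set xs. \<rho> v $ 1 $ 1)"
    and "word_eval \<rho> xs $ 2 $ 2 = (\<Prod>v\<in>set xs. \<rho> v $ 2 $ 2)"
    and "word_eval \<rho> xs $ 3 $ 3 =
      (- 1) ^ length (filter is_Yminus xs) * (\<Prod>v\<in>set xs. \<rho> v $ 1 $ 1)"
  using assms(2,3)
proof (induction xs)
  case Nil
  { case 1 then show ?case by (simp add: mat_1_in_A_comp) }
  { case 2 then show ?case by (simp add: mat_def) }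
  { case 3 then show ?case by (simp add: mat_def) }
  { case 4 then show ?case by (simp add: mat_def) }
next
  case (Cons v xs)
  { case 1
    then show ?case
      using A_comp_mult[OF even_var_dom(1)[of v "\<rho> v"] Cons(1)] assms(1) by simp }
  { case 2
    then have "\<rho> v \<in> A_comp 0" "word_eval \<rho> xs \<in> A_comp 0"
      using even_var_dom(1)[of v "\<rho> v"] Cons(1) assms(1) by simp_all
    then show ?case
      using 2 Cons(2) by (simp add: in_A_comp_iff UT3_def matrix_matrix_mult_def sum_3) }
  { case 3
    then have "\<rho> v \<in> A_comp 0" "word_eval \<rho> xs \<in> A_comp 0"
      using even_var_dom(1)[of v "\<rho> v"] Cons(1) assms(1) by simp_all
    then show ?case
      using 3 Cons(3) by (simp add: in_A_comp_iff UT3_def matrix_matrix_mult_def sum_3) }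
  { case 4
    then have "\<rho> v \<in> A_comp 0" "word_eval \<rho> xs \<in> A_comp 0"
      using even_var_dom(1)[of v "\<rho> v"] Cons(1) assms(1) by simp_all
    then show ?case
      using 4 Cons(4) even_var_dom(2)[of v "\<rho> v"] assms(1)
      by (simp add: in_A_comp_iff UT3_def matrix_matrix_mult_def sum_3) }
qed

text \<open>
  The (1,3) entry of a product sums over the paths from 1 to 3. With even factors a path never meets
  2 and so jumps exactly once: before the jump it collects (1,1) entries and after it (3,3) entries,
  which are the (1,1) entries up to a sign for each skew variable.
\<close>

lemma even_word_corner:
  fixes \<rho> :: "svar \<Rightarrow> ('a::field_char_0)^3^3"
  assumes "\<And>v. \<rho> v \<in> var_dom v" and "\<forall>v\<in>set xs. \<not> odd_var v" and "distinct xs"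
  shows "word_eval \<rho> xs $ 1 $ 3 =
    (\<Sum>v\<in>set xs. (- 1) ^ Yminus_after v xs * (\<rho> v $ 1 $ 3 * (\<Prod>u\<in>set xs - {v}. \<rho> u $ 1 $ 1)))"
  using assms(2,3)
proof (induction xs)
  case Nil
  show ?case by (simp add: mat_def)
next
  case (Cons v xs)
  let ?p = "\<lambda>u. \<rho> u $ 1 $ 1" and ?d = "\<lambda>u. \<rho> u $ 1 $ 3"
  have "\<rho> v \<in> A_comp 0" and W: "word_eval \<rho> xs \<in> A_comp 0"
    "word_eval \<rho> xs $ 3 $ 3 = (- 1) ^ length (filter is_Yminus xs) * (\<Prod>v\<in>set xs. ?p v)"
    using even_var_dom(1)[of v "\<rho> v"] even_word_diagonal[of \<rho> xs] Cons.prems assms(1) by simp_all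
  then have "word_eval \<rho> (v # xs) $ 1 $ 3 =
      ?p v * word_eval \<rho> xs $ 1 $ 3 + ?d v * word_eval \<rho> xs $ 3 $ 3"
    by (simp add: in_A_comp_iff UT3_def matrix_matrix_mult_def sum_3)
  also have "?d v * word_eval \<rho> xs $ 3 $ 3 =
      (- 1) ^ Yminus_after v (v # xs) * (?d v * (\<Prod>u\<in>set (v # xs) - {v}. ?p u))"
    using Cons.prems by (simp add: W(2) Yminus_after_def)
  also have "?p v * word_eval \<rho> xs $ 1 $ 3 =
      (\<Sum>u\<in>set xs. (- 1) ^ Yminus_after u (v # xs) * (?d u * (\<Prod>u\<in>set (v # xs) - {u}. ?p u)))"
  proof -
    have IH: "word_eval \<rho> xs $ 1 $ 3 =
        (\<Sum>u\<in>set xs. (- 1) ^ Yminus_after u xs * (?d u * (\<Prod>u\<in>set xs - {u}. ?p u)))"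
      using Cons by simp
    show ?thesis
      unfolding IH sum_distrib_left
    proof (rule sum.cong[OF refl])
      fix u assume u: "u \<in> set xs"
      then have "u \<noteq> v"
        using Cons.prems by auto
      then have "set (v # xs) - {u} = insert v (set xs - {u})"
        by auto
      then show "?p v * ((- 1) ^ Yminus_after u xs * (?d u * (\<Prod>u\<in>set xs - {u}. ?p u))) =
          (- 1) ^ Yminus_after u (v # xs) * (?d u * (\<Prod>u\<in>set (v # xs) - {u}. ?p u))"
        using \<open>u \<noteq> v\<close> Cons.prems by (simp add: Yminus_after_def)
    qed
  qed
  finally show ?case
    using Cons.prems by simp
qed


lemma even_poly_entries:
  fixes f :: "('a::field_char_0) free_alg"
  assumes f: "multilinear_in V f" and even: "\<forall>v\<in>V. \<not> odd_var v" and \<rho>: "\<And>v. \<rho> v \<in> var_dom v"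
  shows "poly_eval \<rho> f \<in> A_comp 0"
    and "poly_eval \<rho> f $ 1 $ 1 = coeff_sum f * (\<Prod>v\<in>V. \<rho> v $ 1 $ 1)"
    and "poly_eval \<rho> f $ 2 $ 2 = coeff_sum f * (\<Prod>v\<in>V. \<rho> v $ 2 $ 2)"
    and "poly_eval \<rho> f $ 3 $ 3 = (- 1) ^ card {v \<in> V. is_Yminus v} * poly_eval \<rho> f $ 1 $ 1"
    and "poly_eval \<rho> f $ 1 $ 3 =
      (\<Sum>v\<in>V. corner_coeff v f * (\<rho> v $ 1 $ 3 * (\<Prod>u\<in>V - {v}. \<rho> u $ 1 $ 1)))"
proof -
  let ?K = "Poly_Mapping.keys f" and ?c = "Poly_Mapping.lookup f" and ?k = "card {v \<in> V. is_Yminus v}"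
  have xs: "set xs = V" "distinct xs" "\<forall>v\<in>set xs. \<not> odd_var v" "length (filter is_Yminus xs) = ?k"
    if "xs \<in> ?K" for xs
    using that f even length_filter_multilinear[OF f that] by (auto simp: multilinear_in_def)
  show "poly_eval \<rho> f \<in> A_comp 0"
    using xs even_word_diagonal(1)[OF \<rho>] by (intro poly_eval_in_subspace subspace_A_comp) auto
  show 1: "poly_eval \<rho> f $ 1 $ 1 = coeff_sum f * (\<Prod>v\<in>V. \<rho> v $ 1 $ 1)"
    using xs even_word_diagonal(2)[OF \<rho>]
    by (simp add: poly_eval_nth coeff_sum_def sum_distrib_right)
  show "poly_eval \<rho> f $ 2 $ 2 = coeff_sum f * (\<Prod>v\<in>V. \<rho> v $ 2 $ 2)"
    using xs even_word_diagonal(3)[OF \<rho>]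
    by (simp add: poly_eval_nth coeff_sum_def sum_distrib_right)
  show "poly_eval \<rho> f $ 3 $ 3 = (- 1) ^ ?k * poly_eval \<rho> f $ 1 $ 1"
    using xs even_word_diagonal(4)[OF \<rho>] unfolding 1
    by (simp add: poly_eval_nth coeff_sum_def sum_distrib_right sum_distrib_left mult.left_commute)
  have "poly_eval \<rho> f $ 1 $ 3 = (\<Sum>xs\<in>?K. \<Sum>v\<in>V.
      ?c xs * ((- 1) ^ Yminus_after v xs * (\<rho> v $ 1 $ 3 * (\<Prod>u\<in>V - {v}. \<rho> u $ 1 $ 1))))"
    using xs even_word_corner[OF \<rho>] by (simp add: poly_eval_nth sum_distrib_left)
  also have "\<dots> = (\<Sum>v\<in>V. corner_coeff v f * (\<rho> v $ 1 $ 3 * (\<Prod>u\<in>V - {v}. \<rho> u $ 1 $ 1)))"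
    by (subst sum.swap) (simp add: corner_coeff_def sum_distrib_right mult.assoc)
  finally show "poly_eval \<rho> f $ 1 $ 3 =
      (\<Sum>v\<in>V. corner_coeff v f * (\<rho> v $ 1 $ 3 * (\<Prod>u\<in>V - {v}. \<rho> u $ 1 $ 1)))" .
qed

text \<open>
  On even variables the values leave the contribution of any other even variable to the entries (1,1)
  and (1,3) unchanged up to sign: their own entries there are 1 and 0.
\<close>

fun unit_subst :: "svar \<Rightarrow> ('a::field)^3^3" where
  "unit_subst (Yplus _) = mat 1"
| "unit_subst (Yminus _) = E 1 1 - E 3 3"
| "unit_subst _ = 0"

lemma unit_subst_in_var_dom: "unit_subst v \<in> (var_dom v :: (('a::field_char_0)^3^3) set)"
  by (cases v) (simp_all add: in_A_plus_minus_iff in_A_comp_iff UT3_def mat_def E_def)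

lemma unit_subst_nth:
  "\<not> odd_var v \<Longrightarrow> unit_subst v $ 1 $ 1 = 1"
  "\<not> odd_var v \<Longrightarrow> unit_subst v $ 1 $ 3 = 0"
  "\<not> odd_var v \<Longrightarrow> \<not> is_Yminus v \<Longrightarrow> unit_subst v $ 2 $ 2 = 1"
  by (cases v; simp add: mat_def E_def)+

text \<open>
  The sum in the corner entry loses all summands but the one of \<open>v\<close>, because the other variables have
  no corner entry.
\<close>

lemma poly_eval_at_unit_subst:
  fixes f :: "('a::field_char_0) free_alg"
  assumes f: "multilinear_in V f" and even: "\<forall>v\<in>V. \<not> odd_var v" and "finite V"
    and v: "v \<in> V" and x: "x \<in> var_dom v"
  shows "poly_eval (unit_subst(v := x)) f \<in> poly_image f"
    and "poly_eval (unit_subst(v := x)) f $ 1 $ 1 = coeff_sum f * x $ 1 $ 1"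
    and "\<forall>v\<in>V. \<not> is_Yminus v \<Longrightarrow> poly_eval (unit_subst(v := x)) f $ 2 $ 2 = coeff_sum f * x $ 2 $ 2"
    and "poly_eval (unit_subst(v := x)) f $ 1 $ 3 = corner_coeff v f * x $ 1 $ 3"
proof -
  let ?\<rho> = "unit_subst(v := x)"
  have \<rho>: "?\<rho> u \<in> var_dom u" for u
    using x by (simp add: unit_subst_in_var_dom)
  note entries = even_poly_entries[OF f even, of ?\<rho>, OF \<rho>]
  have p: "(\<Prod>u\<in>V - {v}. ?\<rho> u $ 1 $ 1) = 1"
    using even by (intro prod.neutral) (auto simp: unit_subst_nth)
  show "poly_eval ?\<rho> f \<in> poly_image f"
    using \<rho> by (auto simp: poly_image_def)
  show "poly_eval ?\<rho> f $ 1 $ 1 = coeff_sum f * x $ 1 $ 1"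
    using p by (simp add: entries(2) prod.remove[OF \<open>finite V\<close> v])
  show "poly_eval ?\<rho> f $ 2 $ 2 = coeff_sum f * x $ 2 $ 2" if "\<forall>v\<in>V. \<not> is_Yminus v"
  proof -
    have "(\<Prod>u\<in>V - {v}. ?\<rho> u $ 2 $ 2) = 1"
      using even that by (intro prod.neutral) (auto simp: unit_subst_nth)
    then show ?thesis
      by (simp add: entries(3) prod.remove[OF \<open>finite V\<close> v])
  qed
  have "(\<Sum>u\<in>V - {v}. corner_coeff u f * (?\<rho> u $ 1 $ 3 * (\<Prod>u\<in>V - {u}. ?\<rho> u $ 1 $ 1))) = 0"
    using even by (intro sum.neutral) (auto simp: unit_subst_nth)
  then show "poly_eval ?\<rho> f $ 1 $ 3 = corner_coeff v f * x $ 1 $ 3"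
    using p by (simp add: entries(5) sum.remove[OF \<open>finite V\<close> v])
qed


lemma poly_image_even_subset:
  fixes f :: "('a::field_char_0) free_alg"
  assumes f: "multilinear_in V f" and even: "\<forall>v\<in>V. \<not> odd_var v" and fin: "finite V"
    and M: "M \<in> poly_image f"
  shows "M \<in> A_comp 0"
    and "M $ 3 $ 3 = (- 1) ^ card {v \<in> V. is_Yminus v} * M $ 1 $ 1"
    and "\<forall>v\<in>V. \<not> is_Yminus v \<Longrightarrow> M $ 1 $ 3 = 0"
    and "v \<in> V \<Longrightarrow> is_Yminus v \<Longrightarrow> M $ 2 $ 2 = 0"
    and "coeff_sum f = 0 \<Longrightarrow> M $ 1 $ 1 = 0 \<and> M $ 2 $ 2 = 0"
    and "\<forall>v\<in>V. is_Yminus v \<longrightarrow> corner_coeff v f = 0 \<Longrightarrow> M $ 1 $ 3 = 0"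
proof -
  obtain \<rho> where \<rho>: "\<And>v. \<rho> v \<in> var_dom v" and M: "M = poly_eval \<rho> f"
    using M by (auto simp: poly_image_def)
  note entries = even_poly_entries[OF f even, of \<rho>, OF \<rho>, folded M]
  show "M \<in> A_comp 0" "M $ 3 $ 3 = (- 1) ^ card {v \<in> V. is_Yminus v} * M $ 1 $ 1"
    by (fact entries)+
  show "coeff_sum f = 0 \<Longrightarrow> M $ 1 $ 1 = 0 \<and> M $ 2 $ 2 = 0"
    using entries(2,3) by simp
  have d: "\<rho> v $ 1 $ 3 = 0" if "v \<in> V" "\<not> is_Yminus v" for v
    using even_var_dom(4)[of v "\<rho> v"] even \<rho> that by simp
  show corner: "M $ 1 $ 3 = 0" if "\<forall>v\<in>V. is_Yminus v \<longrightarrow> corner_coeff v f = 0"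
    unfolding entries(5) using that d by (intro sum.neutral) auto
  show "M $ 1 $ 3 = 0" if "\<forall>v\<in>V. \<not> is_Yminus v"
    using corner that by blast
  show "M $ 2 $ 2 = 0" if "v \<in> V" "is_Yminus v"
  proof -
    have "\<rho> v $ 2 $ 2 = 0"
      using even_var_dom(3)[of v "\<rho> v"] even \<rho> that by simp
    then show ?thesis
      using that fin by (auto simp: entries(3) prod_zero_iff)
  qed
qed

text \<open>
  For a given \<open>M\<close>, a single variable has to produce both its diagonal and its corner. If there
  are skew variables, this is done by one with nonzero \<open>corner_coeff\<close> unless there is none, in
  which case \<open>M\<close> has no corner to be produced.
\<close>

lemma poly_image_even_iff:
  fixes f :: "('a::field_char_0) free_alg"
  assumes f: "multilinear_in V f" and even: "\<forall>v\<in>V. \<not> odd_var v" and fin: "finite V"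
    and nonempty: "V \<noteq> {}"
  defines "k \<equiv> card {v \<in> V. is_Yminus v}"
    and "vanishes \<equiv> \<forall>v\<in>V. is_Yminus v \<longrightarrow> corner_coeff v f = 0"
  shows "M \<in> poly_image f \<longleftrightarrow>
    M \<in> A_comp 0 \<and> M $ 3 $ 3 = (- 1) ^ k * M $ 1 $ 1 \<and>
    (if k = 0 then M $ 1 $ 3 = 0 else M $ 2 $ 2 = 0) \<and>
    (coeff_sum f = 0 \<longrightarrow> M $ 1 $ 1 = 0 \<and> M $ 2 $ 2 = 0) \<and> (vanishes \<longrightarrow> M $ 1 $ 3 = 0)"
    (is "_ \<longleftrightarrow> ?shape")
proof
  note upper = poly_image_even_subset[OF f even fin, folded k_def vanishes_def]
  have k0: "k = 0 \<longleftrightarrow> (\<forall>v\<in>V. \<not> is_Yminus v)"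
    using fin by (auto simp: k_def)
  show ?shape if "M \<in> poly_image f"
    using upper[OF that] k0 by auto
  show "M \<in> poly_image f" if M: ?shape
  proof -
    let ?s = "coeff_sum f"
    have attained: "M \<in> poly_image f"
      if "v \<in> V" "x \<in> var_dom v" "?s * x $ 1 $ 1 = M $ 1 $ 1"
        "corner_coeff v f * x $ 1 $ 3 = M $ 1 $ 3" "k = 0 \<Longrightarrow> ?s * x $ 2 $ 2 = M $ 2 $ 2" for v x
    proof -
      let ?N = "poly_eval (unit_subst(v := x)) f"
      note at = poly_eval_at_unit_subst[OF f even fin that(1,2)]
      have "?N $ 2 $ 2 = M $ 2 $ 2"
        using M that(5) at(3) upper(4)[OF at(1)] k0 by (auto split: if_splits)
      then have "?N = M"
        using upper(1,2)[OF at(1)] M that(3,4) at(2,4)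
        by (simp add: in_A_comp_iff UT3_def vec_eq_iff forall_3)
      then show ?thesis
        using at(1) by simp
    qed
    \<comment> \<open>A quotient by zero is zero. This is the right value below: if \<open>coeff_sum f = 0\<close>, the diagonal of
      \<open>M\<close> is zero, and \<open>v\<close> is chosen so that \<open>corner_coeff v f = 0\<close> only if \<open>M\<close> has no corner.\<close>
    show ?thesis
    proof (cases "k = 0")
      case True
      obtain v where v: "v \<in> V"
        using nonempty by blast
      let ?x = "mscale (M $ 1 $ 1 / ?s) (E 1 1 + E 3 3) + mscale (M $ 2 $ 2 / ?s) (E 2 2)"
      have "?x \<in> var_dom v"
        using v True k0 even
        by (cases v) (auto simp: in_A_plus_minus_iff in_A_comp_iff mat3_simps)
      then show ?thesis
        using M True by (intro attained[OF v, of ?x]) (auto simp: E_def)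
    next
      case False
      obtain v where v: "v \<in> V" "is_Yminus v" "corner_coeff v f = 0 \<longrightarrow> vanishes"
        using False k0 unfolding vanishes_def by blast
      let ?x = "mscale (M $ 1 $ 1 / ?s) (E 1 1 - E 3 3) +
        mscale (M $ 1 $ 3 / corner_coeff v f) (E 1 3)"
      have "?x \<in> var_dom v"
        using v(2) by (cases v) (auto simp: in_A_plus_minus_iff in_A_comp_iff mat3_simps)
      then show ?thesis
        using M v(3) False by (intro attained[OF v(1), of ?x]) (auto simp: E_def)
    qed
  qed
qed

text \<open>
  A single skew variable has no other one after it, so all the signs in \<open>corner_coeff\<close> are 1. This is
  why the image is all of \<open>A_minus 0\<close> in this case.
\<close>

lemma corner_coeff_single_Yminus:
  assumes f: "multilinear_in V f" and v: "{u \<in> V. is_Yminus u} = {v}"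
  shows "corner_coeff v f = coeff_sum f"
proof -
  have "Yminus_after v xs = 0" if xs: "xs \<in> Poly_Mapping.keys f" for xs
  proof -
    have V: "distinct xs" "set xs = V"
      using f xs by (auto simp: multilinear_in_def)
    then obtain ys where ys: "dropWhile (\<lambda>u. u \<noteq> v) xs = v # ys"
      using v by (cases "dropWhile (\<lambda>u. u \<noteq> v) xs")
        (auto simp: dropWhile_eq_Nil_conv dropWhile_eq_Cons_conv)
    have "v \<notin> set ys" "set ys \<subseteq> V"
      using distinct_dropWhile[OF V(1), of "\<lambda>u. u \<noteq> v"] set_dropWhileD[of _ "\<lambda>u. u \<noteq> v" xs] V(2)
      unfolding ys by auto
    then have "filter is_Yminus ys = []"
      using v by (auto simp: filter_empty_conv)
    then show ?thesis
      by (simp add: Yminus_after_def ys)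
  qed
  then show ?thesis
    by (simp add: corner_coeff_def coeff_sum_def)
qed

lemma poly_image_even_plane:
  fixes f :: "('a::field_char_0) free_alg"
  assumes "multilinear_in V f" and "\<forall>v\<in>V. \<not> odd_var v" and "finite V" and "V \<noteq> {}"
  shows "\<exists>p q. poly_image f \<subseteq> mat3.span {p, q}"
proof -
  define k where "k = card {v \<in> V. is_Yminus v}"
  let ?p = "E 1 1 + mscale ((- 1) ^ k) (E 3 3)" and ?q = "if k = 0 then E 2 2 else E 1 3"
  have "M \<in> mat3.span {?p, ?q}" if "M \<in> poly_image f" for M
  proof -
    have "M = mscale (M $ 1 $ 1) ?p + mscale (if k = 0 then M $ 2 $ 2 else M $ 1 $ 3) ?q"
      using that unfolding poly_image_even_iff[OF assms] k_def[symmetric]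
      by (auto simp: in_A_comp_iff mat3_simps)
    then show ?thesis
      unfolding mat3.span_doubleton by blast
  qed
  then show ?thesis by blast
qed

lemma poly_image_even:
  fixes f :: "('a::field_char_0) free_alg"
  assumes f: "multilinear_in V f" and even: "\<forall>v\<in>V. \<not> odd_var v" and fin: "finite V"
    and nonempty: "V \<noteq> {}"
  defines "k \<equiv> card {v \<in> V. is_Yminus v}"
    and "vanishes \<equiv> \<forall>v\<in>V. is_Yminus v \<longrightarrow> corner_coeff v f = 0"
  shows "poly_image f =
    (if coeff_sum f = 0 then if vanishes then {0} else mat3.span {E 1 3}
     else if k = 0 then A_plus 0
     else if k = 1 then A_minus 0
     else if vanishes then {mscale a (E 1 1) + mscale ((- 1) ^ k * a) (E 3 3) | a. True}
     else {mscale a (E 1 1) + mscale b (E 1 3) + mscale ((- 1) ^ k * a) (E 3 3) | a b. True})"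
    (is "_ = ?R")
proof (rule set_eqI)
  fix M :: "'a^3^3"
  note iff = poly_image_even_iff[OF f even fin nonempty, folded k_def vanishes_def, of M]
  have k0: "vanishes" if "k = 0"
    using that fin by (auto simp: k_def vanishes_def)
  have k1: "\<not> vanishes" if "k = 1" "coeff_sum f \<noteq> 0"
  proof -
    obtain v where v: "{u \<in> V. is_Yminus u} = {v}"
      using \<open>k = 1\<close> unfolding k_def by (rule card_1_singletonE)
    show ?thesis
      using corner_coeff_single_Yminus[OF f v] v that(2) by (auto simp: vanishes_def)
  qed
  show "M \<in> poly_image f \<longleftrightarrow> M \<in> ?R"
    unfolding iff using k0 k1
    by (auto simp: mat3.span_singleton in_A_plus_minus_iff in_A_comp_iff mat3_simps)
qed

section \<open>Realizing subspaces of the odd part\<close>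

lemma poly_eval_superset:
  assumes "finite S" and "Poly_Mapping.keys f \<subseteq> S"
  shows "poly_eval \<rho> f = (\<Sum>xs\<in>S. mscale (Poly_Mapping.lookup f xs) (word_eval \<rho> xs))"
  unfolding poly_eval_def
  using assms by (intro sum.mono_neutral_left) (auto simp: in_keys_iff)

lemma transposed_monomials_in_multilinear_polys:
  "fscale a (Poly_Mapping.single [w 1, w 2] 1) + fscale b (Poly_Mapping.single [w 2, w 1] 1)
    \<in> multilinear_polys w 2"
proof -
  have "Poly_Mapping.single [w 1, w 2] 1 = monomial w 2 id"
    by (simp add: monomial_def upt_rec numeral_2_eq_2)
  moreover have "Poly_Mapping.single [w 2, w 1] 1 = monomial w 2 (Transposition.transpose 1 2)"
    by (simp add: monomial_def upt_rec numeral_2_eq_2)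
  moreover have "id permutes {1..2::nat}" "Transposition.transpose 1 2 permutes {1..2::nat}"
    by (auto intro: permutes_id permutes_swap_id)
  ultimately show ?thesis
    unfolding multilinear_polys_def
    by (intro free_alg.span_add free_alg.span_scale free_alg.span_base) auto
qed

lemma poly_eval_transposed_monomials:
  assumes "u \<noteq> v"
  shows "poly_eval \<rho> (fscale a (Poly_Mapping.single [u, v] 1) + fscale b (Poly_Mapping.single [v, u] 1))
    = mscale a (\<rho> u ** \<rho> v) + mscale b (\<rho> v ** \<rho> u)" (is "poly_eval \<rho> ?f = _")
proof -
  have "Poly_Mapping.keys ?f \<subseteq> {[u, v], [v, u]}"
    by (auto simp: in_keys_iff lookup_add lookup_single when_def split: if_splits)
  then show ?thesis
    using assms by (subst poly_eval_superset) (auto simp: lookup_add lookup_single when_def)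
qed

lemma num_odd_two: "odd_var (w 2) \<Longrightarrow> \<not> odd_var (w 1) \<Longrightarrow> num_odd w 2 = 1"
proof -
  assume "odd_var (w 2)" "\<not> odd_var (w 1)"
  then have "{i \<in> {1..2}. odd_var (w i)} = {2}"
    by (auto simp: numeral_2_eq_2 le_Suc_eq)
  then show ?thesis
    by (simp add: num_odd_def)
qed

text \<open>
  A symmetric even value multiplies the two entries of an odd value by independent scalars, so \<open>y z\<close>
  already has the whole plane as its image.
\<close>

lemma odd_part_is_image:
  "\<exists>v (g :: ('a::field_char_0) free_alg). inj_on v {1..2} \<and> g \<in> multilinear_polys v 2 \<and>
    num_odd v 2 = 1 \<and> poly_image g = A_comp 1"
proof -
  define w where "w i = (if i = 1 then Yplus 0 else Zplus 0)" for i :: nat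
  define g :: "'a free_alg" where
    "g = fscale 1 (Poly_Mapping.single [w 1, w 2] 1) + fscale 0 (Poly_Mapping.single [w 2, w 1] 1)"
  have eval: "poly_eval \<rho> g = \<rho> (Yplus 0) ** \<rho> (Zplus 0)" for \<rho>
    unfolding g_def by (subst poly_eval_transposed_monomials) (simp_all add: w_def)
  have "M \<in> poly_image g" if M: "M \<in> A_comp 1" for M
  proof -
    define \<rho> :: "svar \<Rightarrow> 'a^3^3" where
      "\<rho> = (\<lambda>_. 0)(Yplus 0 := mscale (M $ 1 $ 2) (E 1 1 + E 3 3) + mscale (M $ 2 $ 3) (E 2 2),
        Zplus 0 := E 1 2 + E 2 3)"
    have "\<rho> v \<in> var_dom v" for v
      using subspace_var_dom[of v, THEN mat3.subspace_0]
      by (auto simp: \<rho>_def in_A_plus_minus_iff in_A_comp_iff mat3_simps)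
    moreover have "poly_eval \<rho> g = M"
      using M by (simp add: eval \<rho>_def in_A_comp_iff mat3_simps matrix_matrix_mult_def sum_3)
    ultimately show ?thesis
      unfolding poly_image_def by blast
  qed
  moreover have "poly_image g \<subseteq> A_comp 1"
  proof -
    have "\<rho> (Yplus 0) ** \<rho> (Zplus 0) \<in> A_comp (0 + 1)" if "\<forall>v. \<rho> v \<in> var_dom v"
      for \<rho> :: "svar \<Rightarrow> 'a^3^3"
      using that[THEN spec, of "Yplus 0"] that[THEN spec, of "Zplus 0"]
      by (intro A_comp_mult) (simp_all add: A_plus_def)
    then show ?thesis
      by (auto simp: poly_image_def eval)
  qed
  moreover have "g \<in> multilinear_polys w 2"
    unfolding g_def by (rule transposed_monomials_in_multilinear_polys)
  moreover have "inj_on w {1..2}"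
    by (auto simp: inj_on_def w_def)
  moreover have "num_odd w 2 = 1"
    by (rule num_odd_two) (simp_all add: w_def)
  ultimately show ?thesis by blast
qed

text \<open>
  A skew even value \<open>y\<close> annihilates \<open>E 2 3\<close> from the left and \<open>E 1 2\<close> from the right. So
  \<open>y z\<close> and \<open>z y\<close> are multiples of \<open>E 1 2\<close> and \<open>E 2 3\<close>. For symmetric \<open>z\<close> the multipliers are
  opposite, hence \<open>a (y z) - b (z y)\<close> is always a multiple of \<open>a E 1 2 + b E 2 3\<close>.
\<close>

lemma odd_line_is_image:
  fixes N :: "('a::field_char_0)^3^3"
  assumes N: "N \<in> A_comp 1"
  shows "\<exists>v (g :: 'a free_alg). inj_on v {1..2} \<and> g \<in> multilinear_polys v 2 \<and>
    num_odd v 2 = 1 \<and> poly_image g = mat3.span {N}"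
proof -
  define w where "w i = (if i = 1 then Yminus 0 else Zplus 0)" for i :: nat
  define g :: "'a free_alg" where
    "g = fscale (N $ 1 $ 2) (Poly_Mapping.single [w 1, w 2] 1)
      + fscale (- (N $ 2 $ 3)) (Poly_Mapping.single [w 2, w 1] 1)"
  have eval: "poly_eval \<rho> g = mscale (\<rho> (Yminus 0) $ 1 $ 1 * \<rho> (Zplus 0) $ 1 $ 2) N"
    if "\<forall>v. \<rho> v \<in> var_dom v" for \<rho>
  proof -
    have "\<rho> (Yminus 0) \<in> A_minus 0" "\<rho> (Zplus 0) \<in> A_plus 1"
      using that by (metis var_dom.simps)+
    then show ?thesis
      using N unfolding g_def
      by (subst poly_eval_transposed_monomials)
        (simp_all add: w_def in_A_plus_minus_iff in_A_comp_iff mat3_simps matrix_matrix_mult_def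
          sum_3 algebra_simps)
  qed
  have "mscale c N \<in> poly_image g" for c
  proof -
    define \<rho> :: "svar \<Rightarrow> 'a^3^3" where
      "\<rho> = (\<lambda>_. 0)(Yminus 0 := mscale c (E 1 1 - E 3 3), Zplus 0 := E 1 2 + E 2 3)"
    have "\<forall>v. \<rho> v \<in> var_dom v"
      using subspace_var_dom[THEN mat3.subspace_0]
      by (auto simp: \<rho>_def in_A_plus_minus_iff in_A_comp_iff mat3_simps)
    moreover from this have "poly_eval \<rho> g = mscale c N"
      by (simp add: eval) (simp add: \<rho>_def E_def)
    ultimately show ?thesis
      unfolding poly_image_def by (intro CollectI exI[of _ \<rho>]) simp
  qed
  then have "poly_image g = mat3.span {N}"
    using eval by (auto simp: mat3.span_singleton poly_image_def)
  moreover have "g \<in> multilinear_polys w 2"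
    unfolding g_def by (rule transposed_monomials_in_multilinear_polys)
  moreover have "inj_on w {1..2}"
    by (auto simp: inj_on_def w_def)
  moreover have "num_odd w 2 = 1"
    by (rule num_odd_two) (simp_all add: w_def)
  ultimately show ?thesis by blast
qed

section \<open>The images of multilinear polynomials\<close>

lemma zero_in_poly_image:
  assumes "multilinear_in V f" "V \<noteq> {}"
  shows "(0 :: ('a::field_char_0)^3^3) \<in> poly_image f"
proof -
  have "word_eval (\<lambda>_. 0) xs = (0 :: 'a^3^3)" if "xs \<in> Poly_Mapping.keys f" for xs
    using that assms by (cases xs) (auto simp: multilinear_in_def)
  then have "poly_eval (\<lambda>_. 0) f = 0"
    by (simp add: poly_eval_def)
  then show ?thesis
    using subspace_var_dom[THEN mat3.subspace_0] unfolding poly_image_def by fastforce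
qed

theorem theorem18:
  fixes f :: "('a::field_char_0) free_alg" and w :: "nat \<Rightarrow> svar" and m :: nat
  assumes "1 \<le> m" and "inj_on w {1..m}" and "f \<in> multilinear_polys w m"
  shows "mat3.subspace (poly_image f) \<and>
    (num_odd w m = 0 \<longrightarrow>
      poly_image f =
       (if coeff_sum f = 0 then
          if corner_vanishes w m f then {0} else mat3.span {E 1 3}
        else if num_Yminus w m = 0 then A_plus 0
        else if num_Yminus w m = 1 then A_minus 0
        else if corner_vanishes w m f then
          {mscale a (E 1 1) + mscale ((- 1) ^ num_Yminus w m * a) (E 3 3) | a. True}
        else
          {mscale a (E 1 1) + mscale b (E 1 3) + mscale ((- 1) ^ num_Yminus w m * a) (E 3 3)
            | a b. True})) \<and>
    (num_odd w m = 1 \<longrightarrow> poly_image f \<subseteq> A_comp 1) \<and>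
    (num_odd w m = 2 \<longrightarrow> poly_image f = {0} \<or> poly_image f = mat3.span {E 1 3}) \<and>
    (num_odd w m \<ge> 3 \<longrightarrow> poly_image f = {0}) \<and>
    (\<forall>W :: ('a^3^3) set.
      W = A_comp 1 \<or> (mat3.subspace W \<and> W \<subseteq> A_comp 1 \<and> mat3.dim W = 1) \<longrightarrow>
      (\<exists>n v g. 1 \<le> n \<and> inj_on v {1..n} \<and> g \<in> multilinear_polys v n \<and> num_odd v n = 1 \<and>
        poly_image g = W))"
proof -
  let ?V = "w ` {1..m}"
  have f: "multilinear_in ?V f"
    using assms(2,3) by (rule multilinear_in_multilinear_polys)
  have V: "finite ?V" "?V \<noteq> {}"
    using assms(1) by auto
  have count: "card {i \<in> {1..m}. P (w i)} = card {v \<in> ?V. P v}" for P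
  proof -
    have "{v \<in> ?V. P v} = w ` {i \<in> {1..m}. P (w i)}"
      by auto
    moreover have "inj_on w {i \<in> {1..m}. P (w i)}"
      using assms(2) by (rule inj_on_subset) auto
    ultimately show ?thesis
      by (simp only: card_image)
  qed
  have odd: "num_odd w m = card {v \<in> ?V. odd_var v}" and skew: "num_Yminus w m = card {v \<in> ?V. is_Yminus v}"
    unfolding num_odd_def num_Yminus_def by (rule count)+
  have vanishes: "corner_vanishes w m f \<longleftrightarrow> (\<forall>v\<in>?V. is_Yminus v \<longrightarrow> corner_coeff v f = 0)"
    by (auto simp: corner_vanishes_def)
  have even: "\<forall>v\<in>?V. \<not> odd_var v" if "num_odd w m = 0"
    using that V(1) by (auto simp: odd)
  have zero: "0 \<in> poly_image f"
    using f V(2) by (rule zero_in_poly_image)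
  have one: "poly_image f \<subseteq> A_comp 1" if "num_odd w m = 1"
    using poly_image_one_odd[OF f] that by (simp add: odd)
  have two: "poly_image f \<subseteq> mat3.span {E 1 3}" if "num_odd w m = 2"
    using poly_image_diagonals[OF f] diagonals_from_2 that by (auto simp: odd)
  have three: "poly_image f = {0}" if "num_odd w m \<ge> 3"
    using poly_image_diagonals[OF f] diagonals_from_ge_3[OF that] zero by (auto simp: odd)
  have "\<exists>p q. poly_image f \<subseteq> mat3.span {p, q}"
  proof -
    consider "num_odd w m = 0" | "num_odd w m = 1" | "num_odd w m = 2" | "num_odd w m \<ge> 3"
      by linarith
    then show ?thesis
    proof cases
      case 1
      then show ?thesis
        using poly_image_even_plane[OF f even V] by blast
    next
      case 2
      then show ?thesis
        using one by (auto simp: A_comp_span)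
    next
      case 3
      then show ?thesis
        using two by (metis insert_absorb2)
    next
      case 4
      then show ?thesis
        using three by (simp add: mat3.span_zero)
    qed
  qed
  then have subspace: "mat3.subspace (poly_image f)"
    using subspace_poly_image[OF f V] by blast
  have line: "poly_image f = {0} \<or> poly_image f = mat3.span {E 1 3}" if odd2: "num_odd w m = 2"
  proof (cases "poly_image f \<subseteq> {0}")
    case False
    then obtain M where M: "M \<in> poly_image f" "M \<noteq> 0"
      by blast
    then obtain c where c: "M = mscale c (E 1 3)"
      using two[OF odd2] by (auto simp: mat3.span_singleton)
    then have "E 1 3 = mscale (1 / c) M"
      using M(2) by auto
    then have "E 1 3 \<in> poly_image f"
      using subspace M(1) by (metis mat3.subspace_scale)
    then show ?thesis
      using two[OF odd2] subspace mat3.span_minimal[of "{E 1 3}" "poly_image f"] by blast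
  qed (use zero in blast)
  have realized: "\<exists>n v g. 1 \<le> n \<and> inj_on v {1..n} \<and> g \<in> multilinear_polys v n \<and> num_odd v n = 1 \<and>
      poly_image g = W"
    if W: "W = A_comp 1 \<or> mat3.subspace W \<and> W \<subseteq> A_comp 1 \<and> mat3.dim W = 1" for W :: "('a^3^3) set"
    using W
  proof
    assume "W = A_comp 1"
    then show ?thesis
      using odd_part_is_image[where 'a = 'a] by (metis one_le_numeral)
  next
    assume W: "mat3.subspace W \<and> W \<subseteq> A_comp 1 \<and> mat3.dim W = 1"
    obtain B where B: "B \<subseteq> W" "W \<subseteq> mat3.span B" "card B = mat3.dim W"
      by (rule mat3.basis_exists)
    have "card B = 1"
      using B(3) W by simp
    then obtain N where "B = {N}"
      by (rule card_1_singletonE)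
    then have "W = mat3.span {N}" "N \<in> A_comp 1"
      using B W mat3.span_minimal[of "{N}" W] by auto
    then show ?thesis
      using odd_line_is_image[of N] by (metis one_le_numeral)
  qed
  have even_image: "poly_image f =
       (if coeff_sum f = 0 then
          if corner_vanishes w m f then {0} else mat3.span {E 1 3}
        else if num_Yminus w m = 0 then A_plus 0
        else if num_Yminus w m = 1 then A_minus 0
        else if corner_vanishes w m f then
          {mscale a (E 1 1) + mscale ((- 1) ^ num_Yminus w m * a) (E 3 3) | a. True}
        else
          {mscale a (E 1 1) + mscale b (E 1 3) + mscale ((- 1) ^ num_Yminus w m * a) (E 3 3)
            | a b. True})" if "num_odd w m = 0"
    unfolding vanishes skew by (rule poly_image_even[OF f even[OF that] V])
  show ?thesis
    by (intro conjI impI allI subspace even_image one line three realized)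
qed

end
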